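(* Let $n\ge 1$, let $\alpha\subset\{1,\dots,n\}\times\{1,\dots,n\}$, let $\Sigma_\alpha$ be the associated sparse matrix space and let $G$ be the associated directed graph. If $\Sigma_\alpha$ is stable, then for each $k=1,\dots,n$ the graph $G$ contains a Hamiltonian $k$-subgraph.
   Context: For $\alpha\subset\{1,\dots,n\}\times\{1,\dots,n\}$, the sparse matrix space (SMS) $\Sigma_\alpha\subset\mathbb{R}^{n\times n}$ is the vector space of real $n\times n$ matrices $A=(a_{ij})$ with $a_{ij}=0$ whenever $(i,j)\notin\alpha$ (the entries indexed by $\alpha$ are free). A real square matrix is stable if all its eigenvalues have strictly negative real part. An SMS is stable if it contains a stable matrix, and unstable otherwise. The directed graph associated to $\Sigma_\alpha$ has vertices $v_1,\dots,v_n$ and an edge $(v_i,v_j)$ from $v_i$ to $v_j$ exactly when $(i,j)\in\alpha$; self-loops are allowed. A subgraph of $G=(V,E)$ is a graph $G'=(V',E')$ with $V'\subset V$, $E'\subset E$. Subgraphs are disjoint if their vertex sets are disjoint. A decomposition of a graph is a collection of pairwise disjoint subgraphs whose vertex sets have union the whole vertex set. A Hamiltonian cycle of a directed graph is a directed cycle visiting every vertex exactly once (except that the origin vertex is visited again at the end); for a graph with one vertex this is a self-loop at that vertex, and for a graph with two vertices $u,w$ it consists of the edges $(u,w)$ and $(w,u)$. A Hamiltonian decomposition of a graph is a decomposition into disjoint subgraphs each of which admits a Hamiltonian cycle. A Hamiltonian subgraph of $G$ is a subgraph of $G$ that admits a Hamiltonian decomposition, and a Hamiltonian $k$-subgraph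 is a Hamiltonian subgraph with exactly $k$ vertices. *)

theory Defs
  imports Complex_Main "Jordan_Normal_Form.Char_Poly" "Graph_Theory.Digraph_Component"
begin

section \<open>Sparse matrix spaces and stability\<close>

text \<open>Positions in \<open>\<alpha>\<close> are 1-based, as in the usual notation \<open>A = (a\<^sub>i\<^sub>j)\<close>; the matrix library
  indexes entries from 0.\<close>

definition sparse_matrix_space :: "nat \<Rightarrow> (nat \<times> nat) set \<Rightarrow> real mat set" where
  "sparse_matrix_space n \<alpha> =
     {A \<in> carrier_mat n n. \<forall>i\<in>{1..n}. \<forall>j\<in>{1..n}. (i, j) \<notin> \<alpha> \<longrightarrow> A $$ (i - 1, j - 1) = 0}"

definition stable_mat :: "real mat \<Rightarrow> bool" where
  "stable_mat A \<longleftrightarrow>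
     square_mat A \<and> (\<forall>z. eigenvalue (map_mat complex_of_real A) z \<longrightarrow> Re z < 0)"

definition stable_space :: "real mat set \<Rightarrow> bool" where
  "stable_space S \<longleftrightarrow> (\<exists>A\<in>S. stable_mat A)"

text \<open>The vertex \<open>v\<^sub>i\<close> is represented by the number \<open>i\<close>.\<close>

definition sms_graph :: "nat \<Rightarrow> (nat \<times> nat) set \<Rightarrow> (nat, nat \<times> nat) pre_digraph" where
  "sms_graph n \<alpha> = \<lparr> verts = {1..n}, arcs = \<alpha>, tail = fst, head = snd \<rparr>"

lemma wf_sms_graph:
  assumes "\<alpha> \<subseteq> {1..n} \<times> {1..n}"
  shows "wf_digraph (sms_graph n \<alpha>)"
  using assms by unfold_locales (auto simp: sms_graph_def)

section \<open>Hamiltonian decompositions\<close>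

text \<open>A cycle of the library is a non-empty closed walk that repeats no vertex apart from
  returning to its origin; loops and 2-cycles qualify. Every vertex it visits is the tail of one
  of its arcs, so the condition on tails says that all vertices are visited.\<close>

definition hamiltonian_cycle :: "('a, 'b) pre_digraph \<Rightarrow> 'b list \<Rightarrow> bool" where
  "hamiltonian_cycle G p \<longleftrightarrow> pre_digraph.cycle G p \<and> tail G ` set p = verts G"

definition graph_decomposition :: "('a, 'b) pre_digraph \<Rightarrow> ('a, 'b) pre_digraph set \<Rightarrow> bool" where
  "graph_decomposition G C \<longleftrightarrow>
     (\<forall>H\<in>C. subgraph H G) \<and>
     pairwise (\<lambda>H K. verts H \<inter> verts K = {}) C \<and>
     (\<Union>H\<in>C. verts H) = verts G"

definition hamiltonian_decomposition ::
    "('a, 'b) pre_digraph \<Rightarrow> ('a, 'b) pre_digraph set \<Rightarrow> bool" where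
  "hamiltonian_decomposition G C \<longleftrightarrow>
     graph_decomposition G C \<and> (\<forall>H\<in>C. \<exists>p. hamiltonian_cycle H p)"

definition hamiltonian_subgraph :: "('a, 'b) pre_digraph \<Rightarrow> ('a, 'b) pre_digraph \<Rightarrow> bool" where
  "hamiltonian_subgraph H G \<longleftrightarrow> subgraph H G \<and> (\<exists>C. hamiltonian_decomposition H C)"

definition hamiltonian_k_subgraph ::
    "nat \<Rightarrow> ('a, 'b) pre_digraph \<Rightarrow> ('a, 'b) pre_digraph \<Rightarrow> bool" where
  "hamiltonian_k_subgraph k H G \<longleftrightarrow>
     hamiltonian_subgraph H G \<and> finite (verts H) \<and> card (verts H) = k"

end

theory Submission
  imports Defs "HOL-Combinatorics.Orbits"
begin

text \<open>
  Let \<open>A\<close> be a stable matrix in the space and \<open>\<chi>\<close> its characteristic polynomial. Up to sign, the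
  coefficient of \<open>X\<^sup>n\<^sup>-\<^sup>k\<close> in \<open>\<chi>\<close> is the sum of the principal \<open>k\<close>-minors of \<open>A\<close>. If it is
  nonzero, then some term of the expanded minors is nonzero: there are a set \<open>S\<close> of \<open>k\<close> indices
  and a permutation \<open>p\<close> of \<open>S\<close> such that every entry \<open>A\<^sub>i\<^sub>,\<^sub>p\<^sub>(\<^sub>i\<^sub>)\<close> with \<open>i \<in> S\<close> is nonzero
  (\<open>permutation_of_nonzero_char_poly_coeff\<close>). All these positions lie in \<open>\<alpha>\<close>, so \<open>i \<mapsto> p(i)\<close>
  follows edges of the graph, and the cycles of \<open>p\<close> are disjoint directed cycles that cover
  exactly the \<open>k\<close> vertices of \<open>S\<close> (\<open>hamiltonian_k_subgraph_of_permutation\<close>).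

  Stability enters only through the fact that no coefficient of \<open>\<chi>\<close> vanishes
  (\<open>coeff_nonzero_of_roots_left_half_plane\<close>). This is the Gauss--Lucas theorem for the open left
  half plane: if all roots of a nonconstant complex polynomial lie there, so do the roots of its derivative
  and hence those of every nonzero higher derivative. In particular \<open>0\<close> is not a root of any
  nonzero higher derivative, and the value at \<open>0\<close> of the \<open>j\<close>-th derivative is \<open>j!\<close> times the
  \<open>j\<close>-th coefficient.
\<close>

section \<open>Polynomials with all roots in the open left half plane\<close>

lemma Re_inverse_pos:
  assumes "0 < Re z"
  shows "0 < Re (1 / z)"
  using assms by (auto simp: Re_divide sum_power2_gt_zero_iff zero_less_divide_iff)

text \<open>The logarithmic derivative of a product of linear factors is \<open>\<Sum> 1 / (z - a)\<close>. For \<open>z\<close> in the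
  closed right half plane every \<open>z - a\<close> lies in the open right half plane, which inversion
  preserves.\<close>

lemma Re_logderiv_linear_factors_pos:
  fixes z :: complex
  assumes "0 \<le> Re z" and "as \<noteq> []" and "\<And>a. a \<in> set as \<Longrightarrow> Re a < 0"
  shows "0 < Re (poly (pderiv (\<Prod>a\<leftarrow>as. [:- a, 1:])) z / poly (\<Prod>a\<leftarrow>as. [:- a, 1:]) z)"
  using assms(2,3)
proof (induction as rule: list_nonempty_induct)
  case (single a)
  then have "0 < Re (z - a)" using assms(1) by simp
  then have "0 < Re (1 / (z - a))" by (rule Re_inverse_pos)
  then show ?case by (simp add: pderiv_pCons)
next
  case (cons a as)
  let ?q = "\<Prod>a\<leftarrow>as. [:- a, 1:]"
  have IH: "0 < Re (poly (pderiv ?q) z / poly ?q z)" using cons by simp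
  then have q: "poly ?q z \<noteq> 0" by auto
  have "0 < Re (z - a)" using assms(1) cons.prems[of a] by simp
  then have pos: "0 < Re (1 / (z - a))" and za: "z - a \<noteq> 0"
    by (rule Re_inverse_pos, auto)
  have "poly (pderiv (\<Prod>a\<leftarrow>a # as. [:- a, 1:])) z / poly (\<Prod>a\<leftarrow>a # as. [:- a, 1:]) z
      = ((z - a) * poly (pderiv ?q) z + poly ?q z) / ((z - a) * poly ?q z)"
    by (simp only: list.map prod_list.Cons pderiv_mult)
       (simp add: pderiv_pCons algebra_simps)
  also have "\<dots> = 1 / (z - a) + poly (pderiv ?q) z / poly ?q z"
    using q za by (simp add: divide_simps)
  finally show ?case using pos IH by simp
qed

text \<open>Gauss--Lucas for a half plane: at a root of the derivative outside the half plane, the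
  logarithmic derivative would vanish.\<close>

lemma roots_pderiv_left_half_plane:
  fixes p :: "complex poly"
  assumes roots: "\<And>z. poly p z = 0 \<Longrightarrow> Re z < 0" and "0 < degree p"
    and "poly (pderiv p) z = 0"
  shows "Re z < 0"
proof (rule ccontr)
  assume "\<not> Re z < 0"
  then have z: "0 \<le> Re z" by simp
  obtain as where as: "Polynomial.smult (lead_coeff p) (\<Prod>a\<leftarrow>as. [:- a, 1:]) = p" "length as = degree p"
    using fundamental_theorem_algebra_factorized[of p] by auto
  have "Re a < 0" if "a \<in> set as" for a
  proof (rule roots)
    have "poly (\<Prod>a\<leftarrow>as. [:- a, 1:]) a = 0"
      using that by (induction as) auto
    then show "poly p a = 0" by (metis as(1) poly_smult mult_zero_right)
  qed
  moreover have "as \<noteq> []" using as(2) assms(2) by auto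
  ultimately have "poly (pderiv (\<Prod>a\<leftarrow>as. [:- a, 1:])) z \<noteq> 0"
    using Re_logderiv_linear_factors_pos[OF z, of as] by auto
  moreover have "lead_coeff p \<noteq> 0" using assms(2) by auto
  moreover have "pderiv p = Polynomial.smult (lead_coeff p) (pderiv (\<Prod>a\<leftarrow>as. [:- a, 1:]))"
    by (metis as(1) pderiv_smult)
  ultimately show False using assms(3) by simp
qed

text \<open>Passing to the derivative shifts the coefficients down, up to nonzero factors, and keeps the
  hypothesis on the roots, so that everything reduces to the constant coefficient \<open>p(0)\<close>.\<close>

lemma coeff_nonzero_of_roots_left_half_plane:
  fixes p :: "complex poly"
  assumes "p \<noteq> 0" and "\<And>z. poly p z = 0 \<Longrightarrow> Re z < 0" and "j \<le> degree p"
  shows "coeff p j \<noteq> 0"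
  using assms
proof (induction j arbitrary: p)
  case 0
  then have "poly p 0 \<noteq> 0" by force
  then show ?case by (simp add: poly_0_coeff_0)
next
  case (Suc j)
  have deg: "degree (pderiv p) = degree p - 1" by (rule degree_pderiv)
  have "coeff (pderiv p) j \<noteq> 0"
  proof (rule Suc.IH)
    show "pderiv p \<noteq> 0" using Suc.prems by (simp add: pderiv_eq_0_iff)
    show "Re z < 0" if "poly (pderiv p) z = 0" for z
      using roots_pderiv_left_half_plane[OF _ _ that] Suc.prems by simp
    show "j \<le> degree (pderiv p)" using Suc.prems deg by simp
  qed
  then show ?case by (simp add: coeff_pderiv)
qed

section \<open>Coefficients of the characteristic polynomial and partial permutations\<close>

text \<open>A nonzero term of the expanded product \<open>\<Prod>(c\<^sub>i + d\<^sub>i X)\<close> picks \<open>c\<^sub>i\<close> for \<open>i \<in> S\<close> and \<open>d\<^sub>i X\<close>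
  for the other indices, which therefore number exactly \<open>m\<close>.\<close>

lemma coeff_prod_linear_nonzero:
  fixes c d :: "'i \<Rightarrow> 'a::comm_ring_1"
  assumes "finite A" and "coeff (\<Prod>i\<in>A. [:c i, d i:]) m \<noteq> 0"
  shows "\<exists>S\<subseteq>A. card (A - S) = m \<and> (\<forall>i\<in>S. c i \<noteq> 0) \<and> (\<forall>i\<in>A - S. d i \<noteq> 0)"
  using assms
proof (induction A arbitrary: m)
  case empty
  then show ?case by (auto split: if_splits)
next
  case (insert x A)
  let ?q = "\<Prod>i\<in>A. [:c i, d i:]"
  have "coeff ([:c x, d x:] * ?q) m \<noteq> 0" using insert by simp
  then have "c x * coeff ?q m + (case m of 0 \<Rightarrow> 0 | Suc k \<Rightarrow> d x * coeff ?q k) \<noteq> 0"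
    by (simp add: coeff_pCons split: nat.splits)
  then have "c x * coeff ?q m \<noteq> 0 \<or> (case m of 0 \<Rightarrow> 0 | Suc k \<Rightarrow> d x * coeff ?q k) \<noteq> 0"
    by (metis add_0)
  then have "c x \<noteq> 0 \<and> coeff ?q m \<noteq> 0 \<or> (\<exists>k. m = Suc k \<and> d x \<noteq> 0 \<and> coeff ?q k \<noteq> 0)"
    by (cases m) auto
  then consider "c x \<noteq> 0" "coeff ?q m \<noteq> 0"
    | k where "m = Suc k" "d x \<noteq> 0" "coeff ?q k \<noteq> 0"
    by blast
  then show ?case
  proof cases
    case 1
    then obtain S where S: "S \<subseteq> A" "card (A - S) = m" "\<forall>i\<in>S. c i \<noteq> 0" "\<forall>i\<in>A - S. d i \<noteq> 0"
      using insert.IH by blast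
    have "insert x A - insert x S = A - S" using insert.hyps by auto
    then show ?thesis using S 1 by (intro exI[of _ "insert x S"]) auto
  next
    case 2
    then obtain S where S: "S \<subseteq> A" "card (A - S) = k" "\<forall>i\<in>S. c i \<noteq> 0" "\<forall>i\<in>A - S. d i \<noteq> 0"
      using insert.IH by blast
    have "insert x A - S = insert x (A - S)" using insert.hyps S(1) by auto
    then show ?thesis using S 2 insert.hyps by (intro exI[of _ S]) auto
  qed
qed

text \<open>In the Leibniz expansion of \<open>det (X I - A)\<close>, the permutation \<open>p\<close> contributes a product of linear
  polynomials whose \<open>i\<close>-th factor contains \<open>X\<close> only if \<open>p\<close> fixes \<open>i\<close>. A term of degree \<open>m\<close>
  picks \<open>X\<close> at \<open>m\<close> fixed points of \<open>p\<close>; hence \<open>p\<close> permutes the set \<open>S\<close> of the remaining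
  indices, where entries of \<open>A\<close> were picked.\<close>

lemma permutation_of_nonzero_char_poly_coeff:
  fixes A :: "'a::comm_ring_1 mat"
  assumes A: "A \<in> carrier_mat n n" and "coeff (char_poly A) m \<noteq> 0"
  obtains S p where "S \<subseteq> {0..<n}" "card ({0..<n} - S) = m" "p permutes S"
    "\<And>i. i \<in> S \<Longrightarrow> A $$ (i, p i) \<noteq> 0"
proof -
  have "char_poly A = (\<Sum>p | p permutes {0..<n}.
      signof p * (\<Prod>i = 0..<n. char_poly_matrix A $$ (i, p i)))"
    unfolding char_poly_def using A by (intro det_def') simp
  also have "\<dots> = (\<Sum>p | p permutes {0..<n}.
      signof p * (\<Prod>i = 0..<n. [:- A $$ (i, p i), if p i = i then 1 else 0:]))"
  proof (intro sum.cong arg_cong2[where f = "(*)"] prod.cong refl)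
    fix p i assume "p \<in> {p. p permutes {0..<n}}" "i \<in> {0..<n}"
    then have "i < n" "p i < n" using permutes_in_image[of p "{0..<n}" i] by auto
    then show "char_poly_matrix A $$ (i, p i) = [:- A $$ (i, p i), if p i = i then 1 else 0:]"
      using A by (auto simp: char_poly_matrix_def)
  qed
  finally have expansion: "char_poly A = (\<Sum>p | p permutes {0..<n}.
      signof p * (\<Prod>i = 0..<n. [:- A $$ (i, p i), if p i = i then 1 else 0:]))" .
  have "\<exists>p. p permutes {0..<n} \<and> coeff (signof p *
      (\<Prod>i = 0..<n. [:- A $$ (i, p i), if p i = i then 1 else 0:])) m \<noteq> 0"
  proof (rule ccontr)
    assume "\<not> ?thesis"
    then have "coeff (char_poly A) m = 0"
      unfolding expansion coeff_sum by (intro sum.neutral) simp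
    then show False using assms(2) by contradiction
  qed
  then obtain p where p: "p permutes {0..<n}" and
    "coeff (signof p * (\<Prod>i = 0..<n. [:- A $$ (i, p i), if p i = i then 1 else 0:])) m \<noteq> 0"
    by blast
  then have nz: "coeff (\<Prod>i = 0..<n. [:- A $$ (i, p i), if p i = i then 1 else 0:]) m \<noteq> 0"
    by (cases p rule: sign_cases) simp_all
  obtain S where S: "S \<subseteq> {0..<n}" "card ({0..<n} - S) = m"
      "\<forall>i\<in>S. - A $$ (i, p i) \<noteq> 0" "\<forall>i\<in>{0..<n} - S. (if p i = i then 1 else 0 :: 'a) \<noteq> 0"
    using coeff_prod_linear_nonzero[OF finite_atLeastLessThan nz] by (elim exE conjE)
  have "p permutes S"
    using p
  proof (rule permutes_superset)
    fix i assume "i \<in> {0..<n} - S"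
    with S(4) have "(if p i = i then 1 else 0 :: 'a) \<noteq> 0" by (rule bspec)
    then show "p i = i" by presburger
  qed
  moreover have "A $$ (i, p i) \<noteq> 0" if "i \<in> S" for i
    using S(3) that by simp
  ultimately show thesis by (rule that[OF S(1,2)])
qed

section \<open>Graphs of permutations\<close>

definition permutation_graph :: "('a \<Rightarrow> 'a) \<Rightarrow> 'a set \<Rightarrow> ('a, 'a \<times> 'a) pre_digraph" where
  "permutation_graph f S = \<lparr> verts = S, arcs = (\<lambda>x. (x, f x)) ` S, tail = fst, head = snd \<rparr>"

lemma subgraph_permutation_graph:
  assumes "T \<subseteq> S" and "f ` S \<subseteq> S" and "f ` T \<subseteq> T"
  shows "subgraph (permutation_graph f T) (permutation_graph f S)"
  using assms unfolding subgraph_def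
  by (auto simp: permutation_graph_def compatible_def wf_digraph_def)

text \<open>The closed walk around a cycle of a permutation is handled as the list of consecutive pairs of
  a sequence \<open>g\<close>. The starting index \<open>m\<close> is arbitrary because the induction on the length strips
  pairs from the front.\<close>

lemma cas_consecutive_pairs:
  assumes "tail G = fst" and "head G = snd"
  shows "pre_digraph.cas G (g m) (map (\<lambda>i. (g i, g (Suc i))) [m..<m + n]) (g (m + n))"
proof (induction n arbitrary: m)
  case 0
  then show ?case by (simp add: pre_digraph.cas.simps)
next
  case (Suc n)
  show ?case using Suc[of "Suc m"] assms
    by (simp add: upt_conv_Cons pre_digraph.cas.simps del: upt_Suc)
qed

lemma awalk_verts_consecutive_pairs:
  assumes "tail G = fst" and "head G = snd"
  shows "pre_digraph.awalk_verts G (g m) (map (\<lambda>i. (g i, g (Suc i))) [m..<m + n])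
    = map g [m..<Suc (m + n)]"
proof (induction n arbitrary: m)
  case 0
  then show ?case by (simp add: pre_digraph.awalk_verts.simps)
next
  case (Suc n)
  show ?case using Suc[of "Suc m"] assms
    by (simp add: upt_conv_Cons pre_digraph.awalk_verts.simps del: upt_Suc)
qed

text \<open>The cycle is the orbit \<open>x, f(x), f\<^sup>2(x), \<dots>\<close> up to the first return to \<open>x\<close>; a fixed point
  yields a loop.\<close>

lemma hamiltonian_cycle_cyclic_permutation:
  assumes "inj f" and "cyclic_on f S"
  shows "\<exists>p. hamiltonian_cycle (permutation_graph f S) p"
proof -
  let ?G = "permutation_graph f S"
  obtain x where x: "x \<in> S" "S = orbit f x" using assms(2) by (auto simp: cyclic_on_def)
  define n where "n = funpow_dist1 f x x"
  define g where "g i = (f ^^ i) x" for i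
  have n: "0 < n" by (simp add: n_def)
  have closed: "g n = g 0"
    using x funpow_dist1_prop[of x f x] by (simp only: g_def n_def funpow_0)
  have S: "S = g ` {0..<n}"
    using x orbit_conv_funpow_dist1[of x f] by (simp only: g_def[abs_def] n_def)
  have inj: "inj_on g {0..<n}"
    using x inj_on_funpow_dist1[of x f x] by (simp only: g_def[abs_def] n_def)
  have step: "g (Suc i) = f (g i)" for i by (simp add: g_def)
  define p where "p = map (\<lambda>i. (g i, g (Suc i))) [0..<n]"
  have G: "tail ?G = fst" "head ?G = snd" by (simp_all add: permutation_graph_def)
  have "pre_digraph.cas ?G (g 0) p (g 0)"
    using cas_consecutive_pairs[OF G, of g 0 n] closed by (simp add: p_def)
  moreover have "g 0 \<in> verts ?G" using x by (simp add: permutation_graph_def g_def)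
  moreover have "set p \<subseteq> arcs ?G"
    using S by (auto simp: p_def permutation_graph_def step)
  ultimately have "pre_digraph.awalk ?G (g 0) p (g 0)"
    by (simp add: pre_digraph.awalk_def)
  moreover have "distinct (tl (pre_digraph.awalk_verts ?G (g 0) p))"
  proof -
    have "tl (pre_digraph.awalk_verts ?G (g 0) p) = map g [Suc 0..<Suc n]"
      using awalk_verts_consecutive_pairs[OF G, of g 0 n]
      by (simp add: p_def upt_conv_Cons del: upt_Suc)
    \<comment> \<open>The vertices after the origin are the images under the injective \<open>f\<close> of
      \<open>g 0, \<dots>, g (n - 1)\<close>, which are distinct because \<open>n\<close> is the first return time.\<close>
    also have "\<dots> = map f (map g [0..<n])"
      by (simp add: map_Suc_upt[symmetric] step del: upt_Suc map_Suc_upt)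
    finally show ?thesis using inj assms(1)
      by (simp add: distinct_map comp_inj_on inj_on_subset[OF assms(1)])
  qed
  moreover have "p \<noteq> []" using n by (simp add: p_def)
  ultimately have "pre_digraph.cycle ?G p" unfolding pre_digraph.cycle_def by blast
  moreover have "tail ?G ` set p = verts ?G"
    using S by (auto simp: G p_def permutation_graph_def image_image)
  ultimately show ?thesis unfolding hamiltonian_cycle_def by blast
qed

lemma hamiltonian_decomposition_permutation_graph:
  assumes f: "f permutes S" and "finite S"
  shows "\<exists>C. hamiltonian_decomposition (permutation_graph f S) C"
proof -
  obtain P where P: "\<And>c. c \<in> P \<Longrightarrow> cyclic_on f c" "\<Union>P = S"
    "\<And>c d. c \<in> P \<Longrightarrow> d \<in> P \<Longrightarrow> c \<noteq> d \<Longrightarrow> c \<inter> d = {}"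
    using permutes_decompose[OF assms] by metis
  have "subgraph (permutation_graph f c) (permutation_graph f S)" if "c \<in> P" for c
    using that P f by (intro subgraph_permutation_graph)
      (auto simp: permutes_in_image cyclic_on_inI)
  moreover have "pairwise (\<lambda>H K. verts H \<inter> verts K = {}) (permutation_graph f ` P)"
    using P(3) by (auto simp: pairwise_def permutation_graph_def)
  moreover have "(\<Union>H\<in>permutation_graph f ` P. verts H) = verts (permutation_graph f S)"
    using P(2) by (auto simp: permutation_graph_def)
  ultimately have "graph_decomposition (permutation_graph f S) (permutation_graph f ` P)"
    unfolding graph_decomposition_def by blast
  moreover have "\<exists>p. hamiltonian_cycle (permutation_graph f c) p" if "c \<in> P" for c
    using hamiltonian_cycle_cyclic_permutation permutes_inj[OF f] P(1)[OF that] by blast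
  ultimately show ?thesis unfolding hamiltonian_decomposition_def by blast
qed

lemma hamiltonian_k_subgraph_of_permutation:
  assumes "\<alpha> \<subseteq> {1..n} \<times> {1..n}" and "S \<subseteq> {1..n}" and f: "f permutes S"
    and "\<And>i. i \<in> S \<Longrightarrow> (i, f i) \<in> \<alpha>"
  shows "hamiltonian_k_subgraph (card S) (permutation_graph f S) (sms_graph n \<alpha>)"
proof -
  have fin: "finite S" using assms(2) finite_subset by blast
  have "wf_digraph (permutation_graph f S)"
    using f by (auto simp: wf_digraph_def permutation_graph_def permutes_in_image)
  then have "subgraph (permutation_graph f S) (sms_graph n \<alpha>)"
    using assms(2,4) wf_sms_graph[OF assms(1)] unfolding subgraph_def
    by (auto simp: permutation_graph_def sms_graph_def compatible_def)
  then show ?thesis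
    using hamiltonian_decomposition_permutation_graph[OF f fin] fin
    unfolding hamiltonian_k_subgraph_def hamiltonian_subgraph_def
    by (simp add: permutation_graph_def)
qed

section \<open>Stable sparse matrix spaces\<close>

text \<open>The eigenvalues of \<open>A\<close> are the roots of its characteristic polynomial over the complex
  numbers, which has degree \<open>n\<close>; its coefficient at \<open>n - k\<close> yields an index set of size \<open>k\<close>.\<close>

lemma permutation_of_stable_mat:
  assumes A: "A \<in> carrier_mat n n" and "stable_mat A" and "k \<le> n"
  obtains S p where "S \<subseteq> {0..<n}" "card S = k" "p permutes S"
    "\<And>i. i \<in> S \<Longrightarrow> A $$ (i, p i) \<noteq> 0"
proof -
  let ?B = "map_mat complex_of_real A"
  have B: "?B \<in> carrier_mat n n" using A by simp
  have deg: "degree (char_poly ?B) = n" "coeff (char_poly ?B) n = 1"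
    using degree_monic_char_poly[OF B] by auto
  have "coeff (char_poly ?B) (n - k) \<noteq> 0"
  proof (rule coeff_nonzero_of_roots_left_half_plane)
    show "char_poly ?B \<noteq> 0" using deg(2) by auto
    show "Re z < 0" if "poly (char_poly ?B) z = 0" for z
      using that assms(2) eigenvalue_root_char_poly[OF B] by (simp add: stable_mat_def)
    show "n - k \<le> degree (char_poly ?B)" using deg(1) by simp
  qed
  then obtain S p where S: "S \<subseteq> {0..<n}" "card ({0..<n} - S) = n - k" "p permutes S"
    "\<And>i. i \<in> S \<Longrightarrow> ?B $$ (i, p i) \<noteq> 0"
    using permutation_of_nonzero_char_poly_coeff[OF B] by metis
  have "finite S" using S(1) finite_subset by blast
  then have "card ({0..<n} - S) = n - card S" "card S \<le> n"
    using S(1) card_mono[OF _ S(1)] by (simp_all add: card_Diff_subset)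
  then have "card S = k" using S(2) assms(3) by linarith
  moreover have "A $$ (i, p i) \<noteq> 0" if "i \<in> S" for i
  proof -
    have "i < n" "p i < n" using S(1,3) that permutes_in_image[of p S i] by auto
    then show ?thesis using S(4)[OF that] A by auto
  qed
  ultimately show thesis using that S by blast
qed

theorem theorem2:
  fixes n :: nat and \<alpha> :: "(nat \<times> nat) set"
  assumes "n \<ge> 1"
    and "\<alpha> \<subseteq> {1..n} \<times> {1..n}"
    and "stable_space (sparse_matrix_space n \<alpha>)"
  shows "\<forall>k\<in>{1..n}. \<exists>H. hamiltonian_k_subgraph k H (sms_graph n \<alpha>)"
proof
  fix k assume k: "k \<in> {1..n}"
  obtain A where A: "A \<in> carrier_mat n n" "stable_mat A" and
    zero: "\<And>i j. i \<in> {1..n} \<Longrightarrow> j \<in> {1..n} \<Longrightarrow> (i, j) \<notin> \<alpha> \<Longrightarrow> A $$ (i - 1, j - 1) = 0"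
    using assms(3) by (auto simp: stable_space_def sparse_matrix_space_def)
  obtain S p where S: "S \<subseteq> {0..<n}" "card S = k" and p: "p permutes S"
    and nz: "\<And>i. i \<in> S \<Longrightarrow> A $$ (i, p i) \<noteq> 0"
    using permutation_of_stable_mat[OF A, of k] k by auto
  \<comment> \<open>Matrix indices start at 0 and vertices at 1, so \<open>p\<close> is conjugated by the successor map.\<close>
  define f where "f x = (if x \<in> Suc ` S then Suc (p (inv_into S Suc x)) else x)" for x
  have "f permutes Suc ` S"
    unfolding f_def[abs_def] using p by (rule permutes_bij_inv_into) (simp add: bij_betw_def)
  moreover have "Suc ` S \<subseteq> {1..n}" using S(1) by auto
  moreover have "(x, f x) \<in> \<alpha>" if x: "x \<in> Suc ` S" for x
  proof -
    obtain i where i: "i \<in> S" "x = Suc i" using x by blast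
    then have fx: "f x = Suc (p i)" by (simp add: f_def)
    have "x \<in> {1..n}" "f x \<in> {1..n}"
      using i fx S(1) permutes_in_image[OF p, of i] by auto
    then show ?thesis using zero[of x "f x"] nz[OF i(1)] i(2) fx by auto
  qed
  ultimately have "hamiltonian_k_subgraph (card (Suc ` S)) (permutation_graph f (Suc ` S))
      (sms_graph n \<alpha>)"
    by (intro hamiltonian_k_subgraph_of_permutation[OF assms(2)])
  then show "\<exists>H. hamiltonian_k_subgraph k H (sms_graph n \<alpha>)"
    using S(2) by (auto simp: card_image)
qed

end
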